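(* Let $I\subseteq\mathbb{R}$ be a nonempty interval and let $X$, $\Sigma$, $A_n$, $m_n$, $V=\bigoplus_{n\ge 0}V_n$, $\Pi=\prod_{t\in I}X_t$, $H_*:V\to\mathbb{R}^{\Pi}$ and $h_*:V\to\mathbb{R}$ be as in the context. Let $i_*: H_*(V)\to\mathbb{R}$ be a linear map such that $i_*\circ H_*=h_*$. Then $i_*$ has a linear and continuous extension $F: C(\Pi)\to\mathbb{R}$, where $C(\Pi)$, the space of continuous real-valued functions on $\Pi$, carries the uniform metric.
   Context: Setting. Let $X_0$ be a nonempty locally compact normal Hausdorff space. Put $X=X_0$ if $X_0$ is compact, and otherwise let $X$ be the (Hausdorff) one-point compactification of $X_0$. Let $\Sigma$ be a $\sigma$-algebra on $X$ such that for every $n$ the continuous functions on $X^n$ are measurable with respect to the product $\sigma$-algebra $\bigotimes^n\Sigma$. Let $A_n$ be the real algebra of bounded continuous real functions on $X^n$ ($A_0=\mathbb{R}$). Paths. $X_t=X$ for each $t\in I$; $\Pi=\prod_{t\in I}X_t$ has the product topology; $p_t:\Pi\to X_t$ are the projections. The space $V$. For $n\ge 0$ let $M_n$ be the free real vector space on the set $I^n\times A_n$, let $N_n\subseteq M_n$ be the subspace spanned by all elements $(t,a+rb)-(t,a)-r(t,b)$ with $r\in\mathbb{R}$, $t\in I^n$, $a,b\in A_n$, and put $V_n=M_n/N_n$, $V=\bigoplus_{n\ge0}V_n$. Write $[t,a]$ for the class of $(t,a)$. The map $H_*$. $H_*:V\to\mathbb{R}^{\Pi}$ is the linear map determined by $H_*[(t_1,\dots,t_n),a](\pi)=a(p_{t_1}(\pi),\dots,p_{t_n}(\pi))$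 for $\pi\in\Pi$. Its values are continuous functions on $\Pi$, so $H_*(V)\subseteq C(\Pi)$. The map $h_*$. For each $n$ let $m_n$ be a function assigning to every $n$-element subset of $I$ a finite nonnegative measure on $(X^n,\bigotimes^n\Sigma)$. For $t_1,\dots,t_n\in I$ let $\#$ be the number of elements of $\{t_1,\dots,t_n\}$, write $\{t_1,\dots,t_n\}=\{u_1<\dots<u_{\#}\}$, and let $\phi:\{1,\dots,n\}\to\{1,\dots,\#\}$ be the function with $t_i=u_{\phi(i)}$. Then $h_*:V\to\mathbb{R}$ is the linear map determined by $$h_*[(t_1,\dots,t_n),a]=\int_{X^{\#}}a(x_{\phi(1)},\dots,x_{\phi(n)})\,dm_{\#}(\{t_1,\dots,t_n\}).$$ *)

theory Defs
  imports "HOL-Analysis.Analysis" "HOL-Analysis.Finite_Function_Topology"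
    "HOL-Library.Set_Algebras"
begin

(* The Alexandroff compactification of a space that is already compact has an extra isolated
   point, so in the compact case only the copy of X0 embedded by Some is kept. *)
definition compactified :: "'a topology \<Rightarrow> 'a option topology" where
  "compactified X0 =
     (if compact_space X0 then subtopology (Alexandroff_compactification X0) (Some ` topspace X0)
      else Alexandroff_compactification X0)"

lemma compactified_compact:
  assumes "compact_space X0"
  shows "X0 homeomorphic_space compactified X0"
  using embedding_map_imp_homeomorphic_space[OF embedding_map_Some[of X0]] assms
  by (simp add: compactified_def)

lemma compact_space_compactified: "compact_space (compactified X0)"
proof (cases "compact_space X0")
  case True
  then show ?thesis
    using compactified_compact homeomorphic_compact_space by blast
next
  case False
  then show ?thesis by (simp add: compactified_def)
qed

(* Tuples are indexed by 0, ..., n - 1. *)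
abbreviation pow_top :: "'x topology \<Rightarrow> nat \<Rightarrow> (nat \<Rightarrow> 'x) topology" where
  "pow_top X n \<equiv> product_topology (\<lambda>_. X) {..<n}"

abbreviation pow_sigma :: "'x topology \<Rightarrow> 'x set set \<Rightarrow> nat \<Rightarrow> (nat \<Rightarrow> 'x) measure" where
  "pow_sigma X \<Sigma> n \<equiv> PiM {..<n} (\<lambda>_. sigma (topspace X) \<Sigma>)"

abbreviation path_top :: "real set \<Rightarrow> 'x topology \<Rightarrow> (real \<Rightarrow> 'x) topology" where
  "path_top I X \<equiv> product_topology (\<lambda>_. X) I"

(* Functions on a space are represented by their extensional representatives, so that two of
   them are equal iff they agree on the space. *)
definition A_space :: "'x topology \<Rightarrow> nat \<Rightarrow> ((nat \<Rightarrow> 'x) \<Rightarrow> real) set" where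
  "A_space X n = {a \<in> extensional (topspace (pow_top X n)).
     continuous_map (pow_top X n) euclideanreal a \<and> bounded (a ` topspace (pow_top X n))}"

definition C_space :: "'p topology \<Rightarrow> ('p \<Rightarrow> real) set" where
  "C_space P = {f \<in> extensional (topspace P). continuous_map P euclideanreal f}"

abbreviation uniform_top :: "'p topology \<Rightarrow> ('p \<Rightarrow> real) topology" where
  "uniform_top P \<equiv> mtopology_of (cfunspace P euclidean_metric)"

(* cfunspace carries the sup metric on bounded continuous functions. *)
lemma topspace_uniform_top:
  assumes "compact_space P"
  shows "topspace (uniform_top P) = C_space P"
proof -
  have "bounded (f ` topspace P)" if "continuous_map P euclideanreal f" for f :: "'a \<Rightarrow> real"
    using image_compactin[OF _ that, of "topspace P"] assms
    by (simp add: compact_space_def compact_imp_bounded)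
  then show ?thesis
    by (auto simp: C_space_def)
qed

definition linear_functional_on ::
    "'p set \<Rightarrow> ('p \<Rightarrow> real) set \<Rightarrow> (('p \<Rightarrow> real) \<Rightarrow> real) \<Rightarrow> bool" where
  "linear_functional_on P S L \<longleftrightarrow>
     (\<forall>f\<in>S. \<forall>g\<in>S. \<forall>r. L (\<lambda>p\<in>P. f p + r * g p) = L f + r * L g)"

type_synonym 'x gen = "(nat \<Rightarrow> real) \<times> ((nat \<Rightarrow> 'x) \<Rightarrow> real)"

definition I_tuples :: "real set \<Rightarrow> nat \<Rightarrow> (nat \<Rightarrow> real) set" where
  "I_tuples I n = PiE {..<n} (\<lambda>_. I)"

definition M_space :: "real set \<Rightarrow> 'x topology \<Rightarrow> nat \<Rightarrow> ('x gen \<Rightarrow>\<^sub>0 real) set" where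
  "M_space I X n = {w. Poly_Mapping.keys w \<subseteq> I_tuples I n \<times> A_space X n}"

abbreviation base :: "(nat \<Rightarrow> real) \<Rightarrow> ((nat \<Rightarrow> 'x) \<Rightarrow> real) \<Rightarrow> ('x gen \<Rightarrow>\<^sub>0 real)" where
  "base t a \<equiv> Poly_Mapping.single (t, a) 1"

definition N_space :: "real set \<Rightarrow> 'x topology \<Rightarrow> nat \<Rightarrow> ('x gen \<Rightarrow>\<^sub>0 real) set" where
  "N_space I X n =
     span {base t (\<lambda>x\<in>topspace (pow_top X n). a x + r * b x) - base t a - r *\<^sub>R base t b
           | t a b r. t \<in> I_tuples I n \<and> a \<in> A_space X n \<and> b \<in> A_space X n}"

definition V_comp :: "real set \<Rightarrow> 'x topology \<Rightarrow> nat \<Rightarrow> ('x gen \<Rightarrow>\<^sub>0 real) set set" where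
  "V_comp I X n = (\<lambda>w. w +o N_space I X n) ` M_space I X n"

(* Elements of the direct sum are families of cosets, almost all of them the zero coset. *)
definition V_space :: "real set \<Rightarrow> 'x topology \<Rightarrow> (nat \<Rightarrow> ('x gen \<Rightarrow>\<^sub>0 real) set) set" where
  "V_space I X = {v. (\<forall>n. v n \<in> V_comp I X n) \<and> finite {n. v n \<noteq> N_space I X n}}"

definition V_add ::
    "(nat \<Rightarrow> ('x gen \<Rightarrow>\<^sub>0 real) set) \<Rightarrow> (nat \<Rightarrow> ('x gen \<Rightarrow>\<^sub>0 real) set)
     \<Rightarrow> (nat \<Rightarrow> ('x gen \<Rightarrow>\<^sub>0 real) set)" where
  "V_add v w = (\<lambda>n. v n + w n)"

(* Adding N_space matters only for r = 0. *)
definition V_scale ::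
    "real set \<Rightarrow> 'x topology \<Rightarrow> real \<Rightarrow> (nat \<Rightarrow> ('x gen \<Rightarrow>\<^sub>0 real) set)
     \<Rightarrow> (nat \<Rightarrow> ('x gen \<Rightarrow>\<^sub>0 real) set)" where
  "V_scale I X r v = (\<lambda>n. (\<lambda>w. r *\<^sub>R w) ` v n + N_space I X n)"

definition V_class ::
    "real set \<Rightarrow> 'x topology \<Rightarrow> nat \<Rightarrow> (nat \<Rightarrow> real) \<Rightarrow> ((nat \<Rightarrow> 'x) \<Rightarrow> real)
     \<Rightarrow> (nat \<Rightarrow> ('x gen \<Rightarrow>\<^sub>0 real) set)" where
  "V_class I X n t a = (\<lambda>k. if k = n then base t a +o N_space I X n else N_space I X k)"

definition free_lift :: "('k \<Rightarrow> real) \<Rightarrow> ('k \<Rightarrow>\<^sub>0 real) \<Rightarrow> real" where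
  "free_lift g w = (\<Sum>k\<in>Poly_Mapping.keys w. Poly_Mapping.lookup w k * g k)"

(* The linear map on V with [t,a] mapped to g n t a; free_lift is constant on each coset,
   and the map is the required one, provided that g n t is linear:
   see V_lift_linear and V_lift_class. *)
definition V_lift ::
    "real set \<Rightarrow> 'x topology \<Rightarrow> (nat \<Rightarrow> (nat \<Rightarrow> real) \<Rightarrow> ((nat \<Rightarrow> 'x) \<Rightarrow> real) \<Rightarrow> real)
     \<Rightarrow> (nat \<Rightarrow> ('x gen \<Rightarrow>\<^sub>0 real) set) \<Rightarrow> real" where
  "V_lift I X g v =
     (\<Sum>n | v n \<noteq> N_space I X n. the_elem (free_lift (case_prod (g n)) ` v n))"

definition H_star ::
    "real set \<Rightarrow> 'x topology \<Rightarrow> (nat \<Rightarrow> ('x gen \<Rightarrow>\<^sub>0 real) set) \<Rightarrow> (real \<Rightarrow> 'x) \<Rightarrow> real" where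
  "H_star I X v =
     (\<lambda>\<pi>\<in>topspace (path_top I X). V_lift I X (\<lambda>n t a. a (\<lambda>i\<in>{..<n}. \<pi> (t i))) v)"

definition phi :: "nat \<Rightarrow> (nat \<Rightarrow> real) \<Rightarrow> nat \<Rightarrow> nat" where
  "phi n t i =
     (THE j. j < card (t ` {..<n}) \<and> sorted_list_of_set (t ` {..<n}) ! j = t i)"

definition h_star ::
    "real set \<Rightarrow> 'x topology \<Rightarrow> (nat \<Rightarrow> real set \<Rightarrow> (nat \<Rightarrow> 'x) measure)
     \<Rightarrow> (nat \<Rightarrow> ('x gen \<Rightarrow>\<^sub>0 real) set) \<Rightarrow> real" where
  "h_star I X m =
     V_lift I X (\<lambda>n t a. \<integral>x. a (\<lambda>i\<in>{..<n}. x (phi n t i)) \<partial>m (card (t ` {..<n})) (t ` {..<n}))"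

definition linear_gen ::
    "real set \<Rightarrow> 'x topology \<Rightarrow> (nat \<Rightarrow> (nat \<Rightarrow> real) \<Rightarrow> ((nat \<Rightarrow> 'x) \<Rightarrow> real) \<Rightarrow> real) \<Rightarrow> bool" where
  "linear_gen I X g \<longleftrightarrow> (\<forall>n. \<forall>t\<in>I_tuples I n. \<forall>a\<in>A_space X n. \<forall>b\<in>A_space X n. \<forall>r.
     g n t (\<lambda>x\<in>topspace (pow_top X n). a x + r * b x) = g n t a + r * g n t b)"

lemma lookup_scaleR: "Poly_Mapping.lookup (r *\<^sub>R w) k = r * Poly_Mapping.lookup w k"
  for w :: "'k \<Rightarrow>\<^sub>0 real"
proof -
  have "finite {i. r * Poly_Mapping.lookup w i \<noteq> 0}"
    by (rule finite_subset[of _ "Poly_Mapping.keys w"]) (auto simp: in_keys_iff)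
  then show ?thesis
    by (simp add: scaleR_poly_mapping_def)
qed

lemma free_lift_superset:
  assumes "finite K" "Poly_Mapping.keys w \<subseteq> K"
  shows "free_lift g w = (\<Sum>k\<in>K. Poly_Mapping.lookup w k * g k)"
  unfolding free_lift_def
  by (rule sum.mono_neutral_left) (use assms in \<open>auto simp: in_keys_iff\<close>)

lemma linear_free_lift: "linear (free_lift g)"
proof (rule linearI)
  fix v w :: "'a \<Rightarrow>\<^sub>0 real" and r :: real
  let ?K = "Poly_Mapping.keys v \<union> Poly_Mapping.keys w"
  show "free_lift g (v + w) = free_lift g v + free_lift g w"
    using free_lift_superset[of ?K "v + w" g] free_lift_superset[of ?K v g]
      free_lift_superset[of ?K w g] keys_add[of v w]
    by (simp add: lookup_add algebra_simps sum.distrib)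
  have "Poly_Mapping.keys (r *\<^sub>R v) \<subseteq> Poly_Mapping.keys v"
    by (auto simp: in_keys_iff lookup_scaleR)
  then show "free_lift g (r *\<^sub>R v) = r *\<^sub>R free_lift g v"
    using free_lift_superset[of "Poly_Mapping.keys v" "r *\<^sub>R v" g]
    by (simp add: lookup_scaleR sum_distrib_left mult.assoc free_lift_def)
qed

lemma free_lift_base: "free_lift g (Poly_Mapping.single k 1) = g k"
  by (simp add: free_lift_def)

lemma subspace_N_space: "subspace (N_space I X n)"
  by (simp add: N_space_def)

lemma subspace_M_space: "subspace (M_space I X n)"
proof -
  have "Poly_Mapping.keys (r *\<^sub>R w) \<subseteq> Poly_Mapping.keys w" for r and w :: "'a gen \<Rightarrow>\<^sub>0 real"
    by (auto simp: in_keys_iff lookup_scaleR)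
  then show ?thesis
    using keys_add by (fastforce simp: subspace_def M_space_def)
qed

lemma free_lift_N_space:
  assumes "linear_gen I X g" "w \<in> N_space I X n"
  shows "free_lift (case_prod (g n)) w = 0"
  using assms(2) unfolding N_space_def
proof (rule linear_eq_0_on_span[OF linear_free_lift, rotated])
  fix w
  assume "w \<in> {base t (\<lambda>x\<in>topspace (pow_top X n). a x + r * b x) - base t a - r *\<^sub>R base t b
           | t a b r. t \<in> I_tuples I n \<and> a \<in> A_space X n \<and> b \<in> A_space X n}"
  then show "free_lift (case_prod (g n)) w = 0"
    using assms(1)
    by (auto simp: linear_diff[OF linear_free_lift] linear_cmul[OF linear_free_lift]
        free_lift_base linear_gen_def)
qed

lemma the_elem_free_lift:
  assumes "linear_gen I X g"
  shows "the_elem (free_lift (case_prod (g n)) ` (w +o N_space I X n)) = free_lift (case_prod (g n)) w"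
proof -
  have "free_lift (case_prod (g n)) ` (w +o N_space I X n) = {free_lift (case_prod (g n)) w}"
    using free_lift_N_space[OF assms] subspace_0[OF subspace_N_space[of I X n]]
    by (auto simp: elt_set_plus_def linear_add[OF linear_free_lift] image_iff)
  then show ?thesis by simp
qed

lemma zero_coset: "0 +o N_space I X n = N_space I X n"
  by (auto simp: elt_set_plus_def)

lemma V_lift_superset:
  assumes "linear_gen I X g" "finite K" "{n. v n \<noteq> N_space I X n} \<subseteq> K"
  shows "V_lift I X g v = (\<Sum>n\<in>K. the_elem (free_lift (case_prod (g n)) ` v n))"
  unfolding V_lift_def
proof (rule sum.mono_neutral_left[OF assms(2,3)])
  show "\<forall>n\<in>K - {n. v n \<noteq> N_space I X n}. the_elem (free_lift (case_prod (g n)) ` v n) = 0"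
    using the_elem_free_lift[OF assms(1), of _ 0]
    by (simp add: zero_coset linear_0[OF linear_free_lift])
qed

lemma coset_add:
  "(v +o N_space I X n) + (w +o N_space I X n) = (v + w) +o N_space I X n"
proof -
  have "N_space I X n + N_space I X n = N_space I X n"
    using subspace_add[OF subspace_N_space[of I X n]] subspace_0[OF subspace_N_space[of I X n]]
    by (force simp: set_plus_def)
  then show ?thesis
    by (simp add: set_plus_rearrange)
qed

lemma coset_scale:
  "(\<lambda>u. r *\<^sub>R u) ` (w +o N_space I X n) + N_space I X n = (r *\<^sub>R w) +o N_space I X n"
  (is "?L = ?R")
proof
  show "?L \<subseteq> ?R"
    using subspace_add[OF subspace_N_space[of I X n]] subspace_scale[OF subspace_N_space[of I X n]]
    by (force simp: set_plus_def elt_set_plus_def scaleR_add_right add.assoc)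
  show "?R \<subseteq> ?L"
  proof
    fix u
    assume "u \<in> ?R"
    then obtain z where "z \<in> N_space I X n" "u = r *\<^sub>R w + z"
      by (auto simp: elt_set_plus_def)
    moreover have "w \<in> w +o N_space I X n"
      using subspace_0[OF subspace_N_space[of I X n]] by (force simp: elt_set_plus_def)
    ultimately show "u \<in> ?L"
      by (auto simp: set_plus_def)
  qed
qed

lemma V_spaceE:
  assumes "v \<in> V_space I X"
  obtains w where "\<And>n. w n \<in> M_space I X n" "v = (\<lambda>n. w n +o N_space I X n)"
proof -
  have "\<forall>n. \<exists>w\<in>M_space I X n. v n = w +o N_space I X n"
    using assms by (auto simp: V_space_def V_comp_def image_iff)
  then obtain w where "\<forall>n. w n \<in> M_space I X n \<and> v n = w n +o N_space I X n"
    by metis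
  with that[of w] show thesis by blast
qed

lemma V_space_closed:
  assumes "v \<in> V_space I X" "w \<in> V_space I X"
  shows "V_add v (V_scale I X r w) \<in> V_space I X"
    and "{n. V_add v (V_scale I X r w) n \<noteq> N_space I X n}
           \<subseteq> {n. v n \<noteq> N_space I X n} \<union> {n. w n \<noteq> N_space I X n}"
proof -
  obtain v' where v': "\<And>n. v' n \<in> M_space I X n" "v = (\<lambda>n. v' n +o N_space I X n)"
    using V_spaceE[OF assms(1)] by metis
  obtain w' where w': "\<And>n. w' n \<in> M_space I X n" "w = (\<lambda>n. w' n +o N_space I X n)"
    using V_spaceE[OF assms(2)] by metis
  have eq: "V_add v (V_scale I X r w) n = (v' n + r *\<^sub>R w' n) +o N_space I X n" for n
    by (simp add: V_add_def V_scale_def v' w' coset_scale coset_add)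
  show sub: "{n. V_add v (V_scale I X r w) n \<noteq> N_space I X n}
           \<subseteq> {n. v n \<noteq> N_space I X n} \<union> {n. w n \<noteq> N_space I X n}"
  proof clarify
    fix n
    assume ne: "V_add v (V_scale I X r w) n \<noteq> N_space I X n" and "w n = N_space I X n" "v n = N_space I X n"
    then have "V_add v (V_scale I X r w) n
      = (0 +o N_space I X n) + ((\<lambda>u. r *\<^sub>R u) ` (0 +o N_space I X n) + N_space I X n)"
      by (simp add: V_add_def V_scale_def zero_coset)
    also have "\<dots> = N_space I X n"
      unfolding coset_scale coset_add by (simp add: zero_coset)
    finally show False using ne by simp
  qed
  have "v' n + r *\<^sub>R w' n \<in> M_space I X n" for n
    using v' w' subspace_M_space[of I X n] by (simp add: subspace_add subspace_scale)
  moreover have "finite {n. V_add v (V_scale I X r w) n \<noteq> N_space I X n}"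
    using finite_subset[OF sub] assms by (auto simp: V_space_def)
  ultimately show "V_add v (V_scale I X r w) \<in> V_space I X"
    by (auto simp: V_space_def V_comp_def eq)
qed

lemma V_lift_linear:
  assumes g: "linear_gen I X g" and v: "v \<in> V_space I X" and w: "w \<in> V_space I X"
  shows "V_lift I X g (V_add v (V_scale I X r w)) = V_lift I X g v + r * V_lift I X g w"
proof -
  obtain v' where v': "\<And>n. v' n \<in> M_space I X n" "v = (\<lambda>n. v' n +o N_space I X n)"
    using V_spaceE[OF v] by metis
  obtain w' where w': "\<And>n. w' n \<in> M_space I X n" "w = (\<lambda>n. w' n +o N_space I X n)"
    using V_spaceE[OF w] by metis
  have eq: "V_add v (V_scale I X r w) n = (v' n + r *\<^sub>R w' n) +o N_space I X n" for n
    by (simp add: V_add_def V_scale_def v' w' coset_scale coset_add)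
  let ?K = "{n. v n \<noteq> N_space I X n} \<union> {n. w n \<noteq> N_space I X n}"
  have K: "finite ?K"
    using v w by (simp add: V_space_def)
  have "V_lift I X g (V_add v (V_scale I X r w))
      = (\<Sum>n\<in>?K. free_lift (case_prod (g n)) (v' n + r *\<^sub>R w' n))"
    by (subst V_lift_superset[OF g K V_space_closed(2)[OF v w]])
       (simp add: eq the_elem_free_lift[OF g])
  also have "\<dots> = (\<Sum>n\<in>?K. free_lift (case_prod (g n)) (v' n))
      + r * (\<Sum>n\<in>?K. free_lift (case_prod (g n)) (w' n))"
    by (simp add: linear_add[OF linear_free_lift] linear_cmul[OF linear_free_lift]
        sum.distrib sum_distrib_left)
  also have "(\<Sum>n\<in>?K. free_lift (case_prod (g n)) (v' n)) = V_lift I X g v"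
    by (subst V_lift_superset[OF g K]) (auto simp: v'(2) the_elem_free_lift[OF g])
  also have "(\<Sum>n\<in>?K. free_lift (case_prod (g n)) (w' n)) = V_lift I X g w"
    by (subst V_lift_superset[OF g K]) (auto simp: w'(2) the_elem_free_lift[OF g])
  finally show ?thesis .
qed

lemma V_class_in_V_space:
  assumes "t \<in> I_tuples I n" "a \<in> A_space X n"
  shows "V_class I X n t a \<in> V_space I X"
proof -
  have "base t a \<in> M_space I X n" "0 \<in> M_space I X k" for k
    using assms by (auto simp: M_space_def)
  then have "V_class I X n t a k \<in> V_comp I X k" for k
    by (auto simp: V_class_def V_comp_def zero_coset intro!: image_eqI[of _ _ 0])
  moreover have "finite {k. V_class I X n t a k \<noteq> N_space I X k}"
    by (rule finite_subset[of _ "{n}"]) (auto simp: V_class_def)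
  ultimately show ?thesis by (simp add: V_space_def)
qed

lemma V_lift_class:
  assumes "linear_gen I X g"
  shows "V_lift I X g (V_class I X n t a) = g n t a"
proof -
  have "V_lift I X g (V_class I X n t a)
      = (\<Sum>k\<in>{n}. the_elem (free_lift (case_prod (g k)) ` V_class I X n t a k))"
    by (rule V_lift_superset[OF assms]) (auto simp: V_class_def)
  also have "\<dots> = g n t a"
    by (simp add: V_class_def the_elem_free_lift[OF assms] free_lift_base)
  finally show ?thesis .
qed

lemma linear_gen_H:
  assumes "\<pi> \<in> topspace (path_top I X)"
  shows "linear_gen I X (\<lambda>n t a. a (\<lambda>i\<in>{..<n}. \<pi> (t i)))"
  using assms by (auto simp: linear_gen_def I_tuples_def PiE_iff)

lemma H_star_class:
  assumes "\<pi> \<in> topspace (path_top I X)"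
  shows "H_star I X (V_class I X n t a) \<pi> = a (\<lambda>i\<in>{..<n}. \<pi> (t i))"
  using assms V_lift_class[OF linear_gen_H[OF assms]] by (simp add: H_star_def)

lemma phi:
  assumes "i < n"
  shows "phi n t i < card (t ` {..<n})"
    and "sorted_list_of_set (t ` {..<n}) ! phi n t i = t i"
proof -
  let ?T = "t ` {..<n}"
  have len: "length (sorted_list_of_set ?T) = card ?T"
    by simp
  have "t i \<in> set (sorted_list_of_set ?T)"
    using assms by simp
  then obtain j where j: "j < card ?T" "sorted_list_of_set ?T ! j = t i"
    using len by (metis in_set_conv_nth)
  have "phi n t i < card ?T \<and> sorted_list_of_set ?T ! phi n t i = t i"
    unfolding phi_def
  proof (rule theI[of _ j])
    fix k
    assume "k < card ?T \<and> sorted_list_of_set ?T ! k = t i"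
    then show "k = j"
      using j len distinct_sorted_list_of_set nth_eq_iff_index_eq by metis
  qed (use j in simp)
  then show "phi n t i < card ?T" "sorted_list_of_set ?T ! phi n t i = t i"
    by auto
qed

lemma phi_image_in_pow_top:
  assumes "x \<in> topspace (pow_top X (card (t ` {..<n})))"
  shows "(\<lambda>i\<in>{..<n}. x (phi n t i)) \<in> topspace (pow_top X n)"
  using assms phi(1)[of _ n t] by (auto simp: PiE_iff)

lemma continuous_map_phi:
  "continuous_map (pow_top X (card (t ` {..<n}))) (pow_top X n) (\<lambda>x. \<lambda>i\<in>{..<n}. x (phi n t i))"
  by (auto simp: continuous_map_componentwise phi(1) intro!: continuous_map_product_projection)

definition measure_family ::
    "real set \<Rightarrow> 'x topology \<Rightarrow> 'x set set \<Rightarrow> (nat \<Rightarrow> real set \<Rightarrow> (nat \<Rightarrow> 'x) measure) \<Rightarrow> bool" where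
  "measure_family I X \<Sigma> m \<longleftrightarrow> (\<forall>n U. U \<subseteq> I \<and> finite U \<and> card U = n \<longrightarrow>
     sets (m n U) = sets (pow_sigma X \<Sigma> n) \<and> finite_measure (m n U))"

definition continuous_measurable :: "'x topology \<Rightarrow> 'x set set \<Rightarrow> bool" where
  "continuous_measurable X \<Sigma> \<longleftrightarrow> (\<forall>n f. continuous_map (pow_top X n) euclideanreal f \<longrightarrow>
     f \<in> borel_measurable (pow_sigma X \<Sigma> n))"

lemma space_measure_family:
  assumes "sigma_algebra (topspace X) \<Sigma>" "measure_family I X \<Sigma> m" "t \<in> I_tuples I n"
  shows "space (m (card (t ` {..<n})) (t ` {..<n})) = topspace (pow_top X (card (t ` {..<n})))"
proof -
  have "t ` {..<n} \<subseteq> I"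
    using assms(3) by (auto simp: I_tuples_def)
  then have s: "sets (m (card (t ` {..<n})) (t ` {..<n})) = sets (pow_sigma X \<Sigma> (card (t ` {..<n})))"
    using assms(2) by (simp add: measure_family_def)
  have "space (sigma (topspace X) \<Sigma>) = topspace X"
    using assms(1) by (simp add: sigma_algebra_iff2)
  then show ?thesis
    using sets_eq_imp_space_eq[OF s] by (simp add: space_PiM)
qed

lemma integrable_h:
  assumes \<Sigma>: "sigma_algebra (topspace X) \<Sigma>" and cm: "continuous_measurable X \<Sigma>"
    and m: "measure_family I X \<Sigma> m" and t: "t \<in> I_tuples I n" and a: "a \<in> A_space X n"
  shows "integrable (m (card (t ` {..<n})) (t ` {..<n})) (\<lambda>x. a (\<lambda>i\<in>{..<n}. x (phi n t i)))"
proof -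
  let ?T = "t ` {..<n}" and ?f = "\<lambda>x. a (\<lambda>i\<in>{..<n}. x (phi n t i))"
  let ?m = "m (card ?T) ?T"
  have "?T \<subseteq> I"
    using t by (auto simp: I_tuples_def)
  then have s: "sets ?m = sets (pow_sigma X \<Sigma> (card ?T))" and fin: "finite_measure ?m"
    using m by (auto simp: measure_family_def)
  have "continuous_map (pow_top X (card ?T)) euclideanreal ?f"
    using continuous_map_compose[OF continuous_map_phi, of X n euclideanreal a t] a
    by (simp add: A_space_def o_def)
  then have meas: "?f \<in> borel_measurable ?m"
    using cm measurable_cong_sets[OF s refl] by (auto simp: continuous_measurable_def)
  note sp = space_measure_family[OF \<Sigma> m t]
  obtain B where "\<forall>y\<in>topspace (pow_top X n). norm (a y) \<le> B"
    using a by (auto simp: A_space_def bounded_iff)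
  then have "norm (?f x) \<le> B" if "x \<in> space ?m" for x
    using phi_image_in_pow_top[of x X t n] that unfolding sp by blast
  then have "AE x in ?m. norm (?f x) \<le> B"
    by (rule AE_I2)
  then show ?thesis
    using finite_measure.integrable_const_bound[OF fin, of ?f B] meas by simp
qed

lemma linear_gen_h:
  assumes "sigma_algebra (topspace X) \<Sigma>" "continuous_measurable X \<Sigma>" "measure_family I X \<Sigma> m"
  shows "linear_gen I X
    (\<lambda>n t a. \<integral>x. a (\<lambda>i\<in>{..<n}. x (phi n t i)) \<partial>m (card (t ` {..<n})) (t ` {..<n}))"
  unfolding linear_gen_def
proof (intro allI ballI)
  fix n t a b r
  assume t: "t \<in> I_tuples I n" and a: "a \<in> A_space X n" and b: "b \<in> A_space X n"
  let ?T = "t ` {..<n}" and ?f = "\<lambda>a x. a (\<lambda>i\<in>{..<n}. x (phi n t i)) :: real"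
  let ?m = "m (card ?T) ?T"
  have "x \<in> space ?m \<Longrightarrow> (\<lambda>i\<in>{..<n}. x (phi n t i)) \<in> topspace (pow_top X n)" for x
    unfolding space_measure_family[OF assms(1,3) t] by (rule phi_image_in_pow_top)
  then have "(\<integral>x. ?f (\<lambda>x\<in>topspace (pow_top X n). a x + r * b x) x \<partial>?m) = (\<integral>x. ?f a x + r * ?f b x \<partial>?m)"
    by (intro Bochner_Integration.integral_cong) (simp_all del: topspace_product_topology)
  also have "\<dots> = (\<integral>x. ?f a x \<partial>?m) + r * (\<integral>x. ?f b x \<partial>?m)"
    using integrable_h[OF assms t a] integrable_h[OF assms t b] by simp
  finally show "(\<integral>x. ?f (\<lambda>x\<in>topspace (pow_top X n). a x + r * b x) x \<partial>?m)
      = (\<integral>x. ?f a x \<partial>?m) + r * (\<integral>x. ?f b x \<partial>?m)" .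
qed

lemma h_star_class:
  assumes "sigma_algebra (topspace X) \<Sigma>" "continuous_measurable X \<Sigma>" "measure_family I X \<Sigma> m"
  shows "h_star I X m (V_class I X n t a)
    = (\<integral>x. a (\<lambda>i\<in>{..<n}. x (phi n t i)) \<partial>m (card (t ` {..<n})) (t ` {..<n}))"
  unfolding h_star_def by (rule V_lift_class[OF linear_gen_h[OF assms]])

end

theory Submission
  imports Defs "HOL-Probability.Discrete_Topology"
begin

text \<open>
  Finitely many coordinate functions can be written over one common finite set of times, so every
  element of \<open>H\<^sub>*(V)\<close> has the form \<open>H\<^sub>*[u,b]\<close> with pairwise distinct times \<open>u\<close>. Since \<open>X\<close> is nonempty,
  \<open>b\<close> then takes the same values as \<open>H\<^sub>*[u,b]\<close>, and integrating \<open>b \<le> c\<close> gives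
  \<open>i\<^sub>*(H\<^sub>*[u,b]) \<le> c i\<^sub>*(H\<^sub>*[u,1]) = c i\<^sub>*(1)\<close>. So \<open>i\<^sub>*\<close> is bounded in the supremum norm, and the
  Hahn--Banach theorem extends it from \<open>H\<^sub>*(V)\<close> to all bounded functions on the path space.
\<close>

section \<open>The Hahn--Banach theorem\<close>

text \<open>Partial functionals are represented by their graphs. A subspace of the product that lies below
  the sublinear \<open>p\<close> is automatically the graph of a function.\<close>

lemma hahn_banach_step:
  fixes p :: "'a::real_vector \<Rightarrow> real" and G :: "('a \<times> real) set"
  assumes sub: "\<And>x y. p (x + y) \<le> p x + p y"
    and hom: "\<And>c x. 0 \<le> c \<Longrightarrow> p (c *\<^sub>R x) = c * p x"
    and G: "subspace G" and dom: "\<And>x s. (x, s) \<in> G \<Longrightarrow> s \<le> p x"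
  obtains r where "\<And>x s. (x, s) \<in> span (insert (z, r) G) \<Longrightarrow> s \<le> p x"
proof -
  \<comment> \<open>A value \<open>r\<close> at \<open>z\<close> is admissible when it lies above
    all \<open>s - p (y - z)\<close> and below all \<open>p (y' + z) - s'\<close>. Splitting
    \<open>y + y'\<close> as \<open>(y - z) + (y' + z)\<close> shows that these demands are
    compatible.\<close>
  have sep: "s - p (y - z) \<le> p (y' + z) - s'" if "(y, s) \<in> G" "(y', s') \<in> G" for y s y' s'
  proof -
    have "s + s' \<le> p (y + y')"
      using dom subspace_add[OF G that] by simp
    also have "\<dots> \<le> p (y - z) + p (y' + z)"
      using sub[of "y - z" "y' + z"] by (simp add: algebra_simps)
    finally show ?thesis by simp
  qed
  define L where "L = (\<lambda>(y, s). s - p (y - z)) ` G"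
  \<comment> \<open>This pair makes \<open>L\<close> nonempty and, through \<open>sep\<close>,
    bounds it above, so that its supremum behaves as expected.\<close>
  have z: "(0, 0) \<in> G"
    using subspace_0[OF G] by (simp add: zero_prod_def)
  define r where "r = Sup L"
  have "bdd_above L"
    unfolding L_def bdd_above_def using sep[OF _ z] by fastforce
  then have lower: "s - p (y - z) \<le> r" if "(y, s) \<in> G" for y s
    unfolding r_def using that by (intro cSup_upper) (auto simp: L_def)
  have upper: "r \<le> p (y + z) - s" if "(y, s) \<in> G" for y s
    unfolding r_def using z sep[OF _ that] by (intro cSup_least) (auto simp: L_def)
  show thesis
  proof
    fix x t assume "(x, t) \<in> span (insert (z, r) G)"
    then obtain k where "(x, t) - k *\<^sub>R (z, r) \<in> span G"
      by (auto simp: span_insert)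
    then have yG: "(x - k *\<^sub>R z, t - k * r) \<in> G"
      using G by (simp add: span_eq_iff[THEN iffD2])
    \<comment> \<open>Dividing by \<open>k\<close> or \<open>-k\<close> reduces the coefficient of
      \<open>z\<close> to 1 or -1, the cases settled by \<open>upper\<close> and
      \<open>lower\<close>.\<close>
    have scaled: "((1/c) *\<^sub>R (x - k *\<^sub>R z), (t - k * r) / c) \<in> G" for c
      using subspace_scale[OF G yG, of "1/c"] by simp
    consider "k = 0" | "k > 0" | "k < 0" by linarith
    then show "t \<le> p x"
    proof cases
      case 1
      then show ?thesis using dom[OF yG] by simp
    next
      case 2
      have "(1/k) *\<^sub>R (x - k *\<^sub>R z) + z = (1/k) *\<^sub>R x"
        using 2 by (simp add: scaleR_diff_right)
      then have "r \<le> p x / k - (t - k * r) / k"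
        using upper[OF scaled[of k]] hom[of "1/k" x] 2 by simp
      then show ?thesis using 2 by (simp add: field_simps)
    next
      case 3
      have "(1/(-k)) *\<^sub>R (x - k *\<^sub>R z) - z = (1/(-k)) *\<^sub>R x"
        using 3 by (simp add: scaleR_diff_right)
      then have "(t - k * r) / (-k) - p x / (-k) \<le> r"
        using lower[OF scaled[of "-k"]] hom[of "1/(-k)" x] 3 by simp
      then show ?thesis using 3 by (simp add: field_simps)
    qed
  qed
qed

text \<open>Zorn's lemma gives a maximal subspace of the product that contains \<open>G0\<close> and
  lies below \<open>p\<close>. Since \<open>hahn_banach_step\<close> can adjoin any
  \<open>z\<close>, maximality means that \<open>z\<close> already has a value there.\<close>

lemma hahn_banach_graph:
  fixes p :: "'a::real_vector \<Rightarrow> real" and G0 :: "('a \<times> real) set"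
  assumes sub: "\<And>x y. p (x + y) \<le> p x + p y"
    and hom: "\<And>c x. 0 \<le> c \<Longrightarrow> p (c *\<^sub>R x) = c * p x"
    and G0: "subspace G0" and dom: "\<And>x s. (x, s) \<in> G0 \<Longrightarrow> s \<le> p x"
  obtains F where "linear F" "\<And>x. F x \<le> p x" "\<And>x s. (x, s) \<in> G0 \<Longrightarrow> F x = s"
proof -
  define \<G> where "\<G> = {G. subspace G \<and> G0 \<subseteq> G \<and> (\<forall>(x, s)\<in>G. s \<le> p x)}"
  have "\<exists>G\<in>\<G>. \<forall>G'\<in>\<G>. G \<subseteq> G' \<longrightarrow> G' = G"
  proof (rule subset_Zorn_nonempty)
    show "\<G> \<noteq> {}"
      using G0 dom by (auto simp: \<G>_def)
  next
    fix \<C> assume ne: "\<C> \<noteq> {}" and ch: "subset.chain \<G> \<C>"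
    then have sub\<G>: "\<C> \<subseteq> \<G>" and lin: "\<And>A B. A \<in> \<C> \<Longrightarrow> B \<in> \<C> \<Longrightarrow> A \<subseteq> B \<or> B \<subseteq> A"
      by (auto simp: subset_chain_def)
    have subsp: "subspace A" if "A \<in> \<C>" for A
      using that sub\<G> by (auto simp: \<G>_def)
    have "subspace (\<Union>\<C>)"
      unfolding subspace_def
    proof (intro conjI ballI allI)
      show "0 \<in> \<Union>\<C>"
        using ne subspace_0[OF subsp] by auto
      show "c *\<^sub>R w \<in> \<Union>\<C>" if "w \<in> \<Union>\<C>" for c w
      proof -
        obtain A where A: "A \<in> \<C>" "w \<in> A" using \<open>w \<in> \<Union>\<C>\<close> by (rule UnionE)
        show ?thesis
          by (rule UnionI[OF A(1) subspace_scale[OF subsp[OF A(1)] A(2)]])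
      qed
      fix v w assume "v \<in> \<Union>\<C>" "w \<in> \<Union>\<C>"
      then obtain A B where "A \<in> \<C>" "v \<in> A" "B \<in> \<C>" "w \<in> B" by auto
      then obtain D where D: "D \<in> \<C>" "v \<in> D" "w \<in> D"
        using lin by blast
      show "v + w \<in> \<Union>\<C>"
        by (rule UnionI[OF D(1) subspace_add[OF subsp[OF D(1)] D(2,3)]])
    qed
    then show "\<Union>\<C> \<in> \<G>"
      using ne sub\<G> by (auto simp: \<G>_def)
  qed
  then obtain G where "G \<in> \<G>" and max: "\<And>G'. G' \<in> \<G> \<Longrightarrow> G \<subseteq> G' \<Longrightarrow> G' = G"
    by metis
  then have G: "subspace G" "G0 \<subseteq> G" and Gdom: "\<And>x s. (x, s) \<in> G \<Longrightarrow> s \<le> p x"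
    by (auto simp: \<G>_def)
  have total: "\<exists>r. (z, r) \<in> G" for z
  proof -
    obtain r where r: "\<And>x s. (x, s) \<in> span (insert (z, r) G) \<Longrightarrow> s \<le> p x"
      by (rule hahn_banach_step[OF sub hom G(1) Gdom, of z]) (assumption | rule that)+
    let ?H = "span (insert (z, r) G)"
    have H: "(z, r) \<in> ?H" "G \<subseteq> ?H"
      using span_superset[of "insert (z, r) G"] by auto
    then have "?H \<in> \<G>"
      unfolding \<G>_def using r subspace_span order_trans[OF G(2)] by fast
    then have "?H = G"
      using max H(2) by blast
    then show ?thesis
      using H(1) by auto
  qed
  then obtain F where F: "\<And>z. (z, F z) \<in> G" by metis
  \<comment> \<open>The difference \<open>(0, r - s)\<close> lies in \<open>G\<close>, and
    \<open>p 0 = 0\<close>.\<close>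
  have unique: "r \<le> s" if "(z, r) \<in> G" "(z, s) \<in> G" for z r s
    using Gdom[of 0 "r - s"] subspace_diff[OF G(1) that] hom[of 0 0] by simp
  have eq: "F z = s" if "(z, s) \<in> G" for z s
    using unique[OF F that] unique[OF that F] by simp
  show thesis
  proof
    show "linear F"
    proof (rule linearI)
      show "F (x + y) = F x + F y" for x y
        using subspace_add[OF G(1) F[of x] F[of y]] by (intro eq) simp
      show "F (c *\<^sub>R x) = c *\<^sub>R F x" for c x
        using subspace_scale[OF G(1) F[of x], of c] by (intro eq) simp
    qed
    show "F x \<le> p x" for x
      by (rule Gdom[OF F])
    show "F x = s" if "(x, s) \<in> G0" for x s
      using that G(2) by (intro eq) blast
  qed
qed

text \<open>This is the graph version for the sublinear function \<open>K * norm x\<close>. Because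
  the norm is even, comparing \<open>F\<close> at \<open>x\<close> and \<open>- x\<close> turns the
  one-sided bound into a two-sided one.\<close>

lemma hahn_banach_norm:
  fixes M :: "'a::real_normed_vector set" and f :: "'a \<Rightarrow> real"
  assumes M: "subspace M"
    and lin: "\<And>x y c. x \<in> M \<Longrightarrow> y \<in> M \<Longrightarrow> f (x + c *\<^sub>R y) = f x + c * f y"
    and bound: "\<And>x. x \<in> M \<Longrightarrow> f x \<le> K * norm x" and "0 \<le> K"
  obtains F where "linear F" "\<And>x. \<bar>F x\<bar> \<le> K * norm x" "\<And>x. x \<in> M \<Longrightarrow> F x = f x"
proof -
  define G where "G = (\<lambda>x. (x, f x)) ` M"
  have f0: "f 0 = 0"
    using lin[of 0 0 1] subspace_0[OF M] by simp
  have "subspace G"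
    unfolding subspace_def
  proof (intro conjI ballI allI)
    show "0 \<in> G"
      using f0 subspace_0[OF M] by (force simp: G_def zero_prod_def)
    show "v + w \<in> G" if "v \<in> G" "w \<in> G" for v w
      using that lin[of _ _ 1] subspace_add[OF M] by (force simp: G_def)
    show "c *\<^sub>R w \<in> G" if "w \<in> G" for c w
      using that lin[of 0] f0 subspace_0[OF M] subspace_scale[OF M] by (force simp: G_def)
  qed
  have sub: "K * norm (x + y) \<le> K * norm x + K * norm y" for x y :: 'a
    using mult_left_mono[OF norm_triangle_ineq \<open>0 \<le> K\<close>] by (simp add: distrib_left)
  obtain F where F: "linear F" "\<And>x. F x \<le> K * norm x" "\<And>x s. (x, s) \<in> G \<Longrightarrow> F x = s"
  proof (rule hahn_banach_graph[of "\<lambda>x. K * norm x" G, OF sub _ \<open>subspace G\<close>])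
    show "s \<le> K * norm x" if "(x, s) \<in> G" for x s
      using that bound by (auto simp: G_def)
  qed simp_all
  show thesis
  proof (rule that[OF F(1)])
    show "\<bar>F x\<bar> \<le> K * norm x" for x
      using F(2)[of x] F(2)[of "- x"] linear_neg[OF F(1)] by (simp add: abs_le_iff)
    show "F x = f x" if "x \<in> M" for x
      using F(3) that by (simp add: G_def)
  qed
qed

section \<open>Extending functionals on bounded functions\<close>

text \<open>Over the discrete topology, \<open>bcontfun\<close> is the normed space of all bounded functions.\<close>

definition zero_extension :: "'p set \<Rightarrow> ('p \<Rightarrow> real) \<Rightarrow> 'p discrete \<Rightarrow>\<^sub>C real" where
  "zero_extension P f = Bcontfun (\<lambda>d. if of_discrete d \<in> P then f (of_discrete d) else 0)"

lemma apply_zero_extension: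
  assumes "bounded (f ` P)"
  shows "apply_bcontfun (zero_extension P f) d = (if of_discrete d \<in> P then f (of_discrete d) else 0)"
proof -
  obtain B where "\<forall>p\<in>P. \<bar>f p\<bar> \<le> B"
    using assms by (auto simp: bounded_iff)
  \<comment> \<open>The bound must also cover the value 0 taken outside \<open>P\<close>, and
    \<open>B\<close> could be negative if \<open>P\<close> is empty; hence
    \<open>max B 0\<close>.\<close>
  then have "(\<lambda>d. if of_discrete d \<in> P then f (of_discrete d) else 0) \<in> bcontfun"
    by (intro bcontfun_normI[of _ "max B 0"])
       (auto simp: continuous_on_open_invariant open_discrete le_max_iff_disj)
  then show ?thesis
    by (simp add: zero_extension_def Bcontfun_inverse)
qed

lemma bounded_linear_combination:
  fixes f g :: "'p \<Rightarrow> real"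
  assumes "bounded (f ` P)" "bounded (g ` P)"
  shows "bounded ((\<lambda>p\<in>P. f p + r * g p) ` P)"
proof -
  have "bounded ((\<lambda>p. f p + r *\<^sub>R g p) ` P)"
    by (rule bounded_plus_comp[OF assms(1) bounded_scaleR_comp[OF assms(2)]])
  then show ?thesis by simp
qed

lemma zero_extension_linear:
  assumes "bounded (f ` P)" "bounded (g ` P)"
  shows "zero_extension P (\<lambda>p\<in>P. f p + r * g p) = zero_extension P f + r *\<^sub>R zero_extension P g"
  using assms bounded_linear_combination[OF assms]
  by (intro bcontfun_eqI) (simp add: apply_zero_extension)

lemma norm_zero_extension_le:
  assumes "bounded (f ` P)" "\<And>p. p \<in> P \<Longrightarrow> \<bar>f p\<bar> \<le> c" "P \<noteq> {}"
  shows "norm (zero_extension P f) \<le> c"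
proof (rule norm_bound)
  have "0 \<le> c"
    using assms(2,3) by (meson abs_ge_zero ex_in_conv order_trans)
  then show "norm (apply_bcontfun (zero_extension P f) d) \<le> c" for d
    using assms by (simp add: apply_zero_extension)
qed

text \<open>\<open>zero_extension\<close> carries \<open>S\<close> to a subspace of a normed space,
  where \<open>hahn_banach_norm\<close> applies. The assumption on \<open>L\<close> is one-sided
  because that is what integrating an inequality yields; it is used with \<open>c\<close> equal to
  the norm.\<close>

lemma extend_bounded_functional:
  fixes L :: "('p \<Rightarrow> real) \<Rightarrow> real"
  assumes "P \<noteq> {}" "S \<noteq> {}" and ext: "S \<subseteq> extensional P"
    and bd: "\<And>f. f \<in> S \<Longrightarrow> bounded (f ` P)"
    and closed: "\<And>f g r. f \<in> S \<Longrightarrow> g \<in> S \<Longrightarrow> (\<lambda>p\<in>P. f p + r * g p) \<in> S"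
    and lin: "linear_functional_on P S L"
    and bound: "\<And>f c. f \<in> S \<Longrightarrow> (\<And>p. p \<in> P \<Longrightarrow> f p \<le> c) \<Longrightarrow> L f \<le> K * c"
    and "0 \<le> K"
  obtains F where "linear_functional_on P {f. bounded (f ` P)} F"
    "\<And>f c. bounded (f ` P) \<Longrightarrow> (\<And>p. p \<in> P \<Longrightarrow> \<bar>f p\<bar> \<le> c) \<Longrightarrow> \<bar>F f\<bar> \<le> K * c"
    "\<And>f. f \<in> S \<Longrightarrow> F f = L f"
proof -
  let ?\<Phi> = "zero_extension P"
  \<comment> \<open>Restriction back to \<open>P\<close>. It inverts \<open>?\<Phi>\<close> on
    \<open>S\<close> because members of \<open>S\<close> are extensional.\<close>
  define \<Psi> where "\<Psi> h = (\<lambda>p\<in>P. apply_bcontfun h (discrete p))" for h :: "'p discrete \<Rightarrow>\<^sub>C real"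
  have inv: "\<Psi> (?\<Phi> f) = f" if "f \<in> S" for f
    using that ext bd by (intro extensionalityI[of _ P])
      (auto simp: \<Psi>_def apply_zero_extension discrete_inverse)
  have comb: "?\<Phi> f + r *\<^sub>R ?\<Phi> g = ?\<Phi> (\<lambda>p\<in>P. f p + r * g p)" if "f \<in> S" "g \<in> S" for f g r
    using that bd by (simp add: zero_extension_linear)
  \<comment> \<open>Zero is obtained as \<open>f - f\<close>.\<close>
  have zero: "0 \<in> ?\<Phi> ` S"
  proof -
    obtain f where "f \<in> S" using \<open>S \<noteq> {}\<close> by auto
    then show ?thesis
      using closed[of f f "-1"] comb[of f f "-1"] by force
  qed
  have plus: "x + c *\<^sub>R y \<in> ?\<Phi> ` S" if "x \<in> ?\<Phi> ` S" "y \<in> ?\<Phi> ` S" for x y c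
    using that closed by (auto simp: comb)
  have M: "subspace (?\<Phi> ` S)"
    unfolding subspace_def using zero plus[of _ _ 1] plus[OF zero] by simp
  obtain F where F: "linear F" "\<And>x. \<bar>F x\<bar> \<le> K * norm x" "\<And>x. x \<in> ?\<Phi> ` S \<Longrightarrow> F x = L (\<Psi> x)"
  proof (rule hahn_banach_norm[OF M, of "\<lambda>h. L (\<Psi> h)" K])
    show "L (\<Psi> (x + c *\<^sub>R y)) = L (\<Psi> x) + c * L (\<Psi> y)" if "x \<in> ?\<Phi> ` S" "y \<in> ?\<Phi> ` S" for x y c
      using that lin closed by (auto simp: comb inv linear_functional_on_def)
    show "L (\<Psi> x) \<le> K * norm x" if x: "x \<in> ?\<Phi> ` S" for x
    proof -
      obtain f where f: "f \<in> S" "x = ?\<Phi> f" using x by blast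
      have "f p \<le> norm x" if "p \<in> P" for p
        using norm_bounded[of x "discrete p"] that f(2) bd[OF f(1)]
        by (simp add: apply_zero_extension discrete_inverse)
      then show ?thesis
        using bound[OF f(1)] f by (simp add: inv)
    qed
  qed (use \<open>0 \<le> K\<close> in auto)
  show thesis
  proof (rule that[of "\<lambda>f. F (?\<Phi> f)"])
    show "linear_functional_on P {f. bounded (f ` P)} (\<lambda>f. F (?\<Phi> f))"
      by (simp add: linear_functional_on_def zero_extension_linear linear_add[OF F(1)]
          linear_cmul[OF F(1)])
    show "\<bar>F (?\<Phi> f)\<bar> \<le> K * c" if "bounded (f ` P)" "\<And>p. p \<in> P \<Longrightarrow> \<bar>f p\<bar> \<le> c" for f c
      using F(2)[of "?\<Phi> f"] mult_left_mono[OF norm_zero_extension_le[OF that \<open>P \<noteq> {}\<close>] \<open>0 \<le> K\<close>]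
      by linarith
    show "F (?\<Phi> f) = L f" if "f \<in> S" for f
      using F(3) that by (simp add: inv)
  qed
qed

section \<open>Reduction to distinct times\<close>

text \<open>Coset representatives of the finitely many nonzero components provide the terms.
  \<open>K\<close> and \<open>c\<close> are fixed before \<open>g\<close>, so one finite sum serves
  all paths at once, although \<open>H_star\<close> uses a different \<open>g\<close> for each
  path.\<close>

lemma V_lift_eq_sum:
  assumes "v \<in> V_space I X"
  obtains K c where "finite K"
    "\<And>n t a. (n, t, a) \<in> K \<Longrightarrow> t \<in> I_tuples I n \<and> a \<in> A_space X n"
    "\<And>g. linear_gen I X g \<Longrightarrow> V_lift I X g v = (\<Sum>(n, t, a)\<in>K. c (n, t, a) * g n t a)"
proof -
  obtain w where w: "\<And>n. w n \<in> M_space I X n" "v = (\<lambda>n. w n +o N_space I X n)"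
    using V_spaceE[OF assms] by metis
  define S where "S = {n. v n \<noteq> N_space I X n}"
  define K where "K = (SIGMA n:S. Poly_Mapping.keys (w n))"
  have S: "finite S"
    using assms by (simp add: V_space_def S_def)
  show thesis
  proof (rule that[of K "\<lambda>(n, k). Poly_Mapping.lookup (w n) k"])
    show "finite K"
      using S by (simp add: K_def)
    show "t \<in> I_tuples I n \<and> a \<in> A_space X n" if "(n, t, a) \<in> K" for n t a
      using that w(1)[of n] by (auto simp: K_def M_space_def)
    fix g :: "nat \<Rightarrow> (nat \<Rightarrow> real) \<Rightarrow> ((nat \<Rightarrow> 'a) \<Rightarrow> real) \<Rightarrow> real"
    assume g: "linear_gen I X g"
    have "V_lift I X g v = (\<Sum>n\<in>S. free_lift (case_prod (g n)) (w n))"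
      unfolding V_lift_def S_def[symmetric] using the_elem_free_lift[OF g] w(2) by simp
    also have "\<dots> = (\<Sum>(n, t, a)\<in>K. Poly_Mapping.lookup (w n) (t, a) * g n t a)"
      unfolding free_lift_def K_def by (subst sum.Sigma) (use S in \<open>auto intro!: sum.cong\<close>)
    finally show "V_lift I X g v =
        (\<Sum>(n, t, a)\<in>K. (case (n, t, a) of (n, k) \<Rightarrow> Poly_Mapping.lookup (w n) k) * g n t a)"
      by simp
  qed
qed

lemma A_space_compactI:
  assumes "compact_space X" "continuous_map (pow_top X n) euclideanreal f"
  shows "restrict f (topspace (pow_top X n)) \<in> A_space X n"
proof -
  have "compactin euclideanreal (f ` topspace (pow_top X n))"
    using assms image_compactin[of "pow_top X n" "topspace (pow_top X n)" euclideanreal f]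
    by (simp add: compact_space_product_topology flip: compact_space_def del: topspace_product_topology)
  then have "bounded (f ` topspace (pow_top X n))"
    by (simp add: compact_imp_bounded)
  moreover have "continuous_map (pow_top X n) euclideanreal (restrict f (topspace (pow_top X n)))"
    using assms(2) by (rule continuous_map_eq) simp
  ultimately show ?thesis
    by (simp add: A_space_def)
qed

text \<open>All times occurring in \<open>v\<close> are pooled into one tuple without repetitions,
  and each \<open>a\<close> is pulled back along the selection of its own times. Only the images
  under \<open>H_star\<close> are equated: in \<open>V\<close>, classes over different tuples of
  times are not identified.\<close>

lemma H_star_distinct_times:
  assumes X: "compact_space X" and v: "v \<in> V_space I X"
  obtains N u b where "u \<in> I_tuples I N" "inj_on u {..<N}" "b \<in> A_space X N"
    "H_star I X v = H_star I X (V_class I X N u b)"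
proof -
  obtain K c where K: "finite K" and Kmem: "\<And>n t a. (n, t, a) \<in> K \<Longrightarrow> t \<in> I_tuples I n \<and> a \<in> A_space X n"
    and lift: "\<And>g. linear_gen I X g \<Longrightarrow> V_lift I X g v = (\<Sum>(n, t, a)\<in>K. c (n, t, a) * g n t a)"
    using V_lift_eq_sum[OF v] by blast
  define T where "T = (\<Union>(n, t, a)\<in>K. t ` {..<n})"
  have T: "finite T" "T \<subseteq> I"
    using K Kmem by (auto simp: T_def I_tuples_def PiE_iff)
  define N where "N = card T"
  \<comment> \<open>The enumeration is arbitrary; the times need not increase, since
    \<open>phi\<close> accounts for their order in \<open>h_star\<close>.\<close>
  obtain e where e: "bij_betw e {..<N} T"
    using ex_bij_betw_nat_finite[OF T(1)] by (auto simp: N_def lessThan_atLeast0)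
  define u where "u = restrict e {..<N}"
  have u: "bij_betw u {..<N} T"
    using e by (subst bij_betw_cong[of _ _ e]) (simp_all add: u_def)
  \<comment> \<open>\<open>j s\<close> is the position of the time \<open>s\<close> in
    \<open>u\<close>, so \<open>x (j (t i))\<close> in \<open>b0\<close> is the coordinate of
    \<open>x\<close> belonging to the time \<open>t i\<close>.\<close>
  define j where "j = inv_into {..<N} u"
  have j: "j s < N" "u (j s) = s" if "s \<in> T" for s
    using that u inv_into_into[of s u "{..<N}"] f_inv_into_f[of s u "{..<N}"]
    by (auto simp: j_def bij_betw_def)
  have TI: "t i \<in> T" if "(n, t, a) \<in> K" "i < n" for n t a i
    using that by (auto simp: T_def)
  define b0 where "b0 x = (\<Sum>(n, t, a)\<in>K. c (n, t, a) * a (\<lambda>i\<in>{..<n}. x (j (t i))))" for x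
  have "continuous_map (pow_top X N) euclideanreal (\<lambda>x. a (\<lambda>i\<in>{..<n}. x (j (t i))))"
    if "(n, t, a) \<in> K" for n t a
  proof -
    have "continuous_map (pow_top X N) (pow_top X n) (\<lambda>x. \<lambda>i\<in>{..<n}. x (j (t i)))"
      using j(1) TI[OF that]
      by (auto simp: continuous_map_componentwise intro!: continuous_map_product_projection)
    moreover have "continuous_map (pow_top X n) euclideanreal a"
      using Kmem[OF that] by (simp add: A_space_def)
    ultimately show ?thesis
      using continuous_map_compose by (fastforce simp: o_def)
  qed
  then have "continuous_map (pow_top X N) euclideanreal b0"
    unfolding b0_def
    by (intro continuous_map_sum K) (auto intro!: continuous_map_real_mult)
  then have b: "restrict b0 (topspace (pow_top X N)) \<in> A_space X N"
    by (rule A_space_compactI[OF X])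
  have uI: "u \<in> I_tuples I N"
    using u T(2) by (auto simp: I_tuples_def bij_betw_def u_def)
  have "H_star I X v \<pi> = H_star I X (V_class I X N u (restrict b0 (topspace (pow_top X N)))) \<pi>"
    if \<pi>: "\<pi> \<in> topspace (path_top I X)" for \<pi>
  proof -
    have "H_star I X v \<pi> = (\<Sum>(n, t, a)\<in>K. c (n, t, a) * a (\<lambda>i\<in>{..<n}. \<pi> (t i)))"
      using lift[OF linear_gen_H[OF \<pi>]] \<pi> by (simp add: H_star_def)
    also have "\<dots> = b0 (\<lambda>i\<in>{..<N}. \<pi> (u i))"
      unfolding b0_def
    proof (intro sum.cong refl, clarify)
      fix n t a assume k: "(n, t, a) \<in> K"
      have "(\<lambda>i\<in>{..<n}. \<pi> (t i)) = (\<lambda>i\<in>{..<n}. (\<lambda>i\<in>{..<N}. \<pi> (u i)) (j (t i)))"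
        using j TI[OF k] by (intro restrict_ext) simp
      then show "c (n, t, a) * a (\<lambda>i\<in>{..<n}. \<pi> (t i)) =
          c (n, t, a) * a (\<lambda>i\<in>{..<n}. (\<lambda>i\<in>{..<N}. \<pi> (u i)) (j (t i)))"
        by simp
    qed
    also have "\<dots> = restrict b0 (topspace (pow_top X N)) (\<lambda>i\<in>{..<N}. \<pi> (u i))"
      using uI \<pi> by (auto simp: I_tuples_def PiE_iff)
    finally show ?thesis
      using H_star_class[OF \<pi>] by metis
  qed
  then have "H_star I X v = H_star I X (V_class I X N u (restrict b0 (topspace (pow_top X N))))"
    by (intro extensionalityI[of _ "topspace (path_top I X)"]) (auto simp: H_star_def)
  with uI b u show thesis
    by (intro that) (auto simp: bij_betw_def)
qed

text \<open>The result is the same function for all \<open>n\<close> and \<open>t\<close>, so a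
  functional on the image of \<open>H_star\<close> can be evaluated at the constant one through any
  tuple of times.\<close>

lemma H_star_one:
  assumes "t \<in> I_tuples I n"
  shows "H_star I X (V_class I X n t (\<lambda>x\<in>topspace (pow_top X n). 1))
    = (\<lambda>\<pi>\<in>topspace (path_top I X). 1)"
proof (rule extensionalityI[of _ "topspace (path_top I X)"])
  fix \<pi> assume \<pi>: "\<pi> \<in> topspace (path_top I X)"
  have "(\<lambda>i\<in>{..<n}. \<pi> (t i)) \<in> topspace (pow_top X n)"
    using assms \<pi> by (auto simp: I_tuples_def PiE_iff)
  then show "H_star I X (V_class I X n t (\<lambda>x\<in>topspace (pow_top X n). 1)) \<pi>
      = (\<lambda>\<pi>\<in>topspace (path_top I X). 1) \<pi>"
    using H_star_class[OF \<pi>] \<pi> by (simp del: topspace_product_topology)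
qed (auto simp: H_star_def)

lemma H_star_linear:
  assumes "v \<in> V_space I X" "w \<in> V_space I X"
  shows "H_star I X (V_add v (V_scale I X r w))
    = (\<lambda>\<pi>\<in>topspace (path_top I X). H_star I X v \<pi> + r * H_star I X w \<pi>)"
  using V_lift_linear[OF linear_gen_H assms] by (auto simp: H_star_def)

section \<open>The one-sided bound from integration\<close>

text \<open>With distinct times, prescribed values never conflict, so every point of the power
  \<open>pow_top X N\<close> is read off from some path.\<close>

lemma distinct_times_le:
  assumes X: "topspace X \<noteq> {}" and u: "u \<in> I_tuples I N" "inj_on u {..<N}"
    and le: "\<And>\<pi>. \<pi> \<in> topspace (path_top I X) \<Longrightarrow> H_star I X (V_class I X N u b) \<pi> \<le> c"
    and x: "x \<in> topspace (pow_top X N)"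
  shows "b x \<le> c"
proof -
  obtain z where z: "z \<in> topspace X" using X by blast
  \<comment> \<open>The path runs through the coordinates of \<open>x\<close> at the times in
    \<open>u\<close> and stays at the filler point \<open>z\<close> at all other times.\<close>
  define \<pi> where "\<pi> = (\<lambda>s\<in>I. if s \<in> u ` {..<N} then x (inv_into {..<N} u s) else z)"
  have \<pi>: "\<pi> \<in> topspace (path_top I X)"
    using x z u(2) by (auto simp: \<pi>_def PiE_iff)
  have "(\<lambda>i\<in>{..<N}. \<pi> (u i)) = x"
    using x u by (intro extensionalityI[of _ "{..<N}"]) (auto simp: \<pi>_def PiE_iff I_tuples_def)
  then show ?thesis
    using le[OF \<pi>] H_star_class[OF \<pi>, of N u b] by simp
qed

text \<open>By \<open>distinct_times_le\<close> the inequality \<open>b x \<le> c\<close> holds on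
  the whole power, and it is integrated against the measure attached to \<open>u\<close>. The factor
  after \<open>c\<close> is the total mass of that measure; \<open>c\<close> may have either
  sign.\<close>

lemma h_star_bound:
  assumes X: "topspace X \<noteq> {}"
    and meas: "sigma_algebra (topspace X) \<Sigma>" "continuous_measurable X \<Sigma>" "measure_family I X \<Sigma> m"
    and u: "u \<in> I_tuples I N" "inj_on u {..<N}" and b: "b \<in> A_space X N"
    and le: "\<And>\<pi>. \<pi> \<in> topspace (path_top I X) \<Longrightarrow> H_star I X (V_class I X N u b) \<pi> \<le> c"
  shows "h_star I X m (V_class I X N u b)
    \<le> c * h_star I X m (V_class I X N u (\<lambda>x\<in>topspace (pow_top X N). 1))"
proof -
  let ?T = "u ` {..<N}" and ?one = "\<lambda>x\<in>topspace (pow_top X N). 1 :: real"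
  \<comment> \<open>\<open>?\<rho>\<close> rearranges coordinates listed by increasing time into the
    order of \<open>u\<close>.\<close>
  let ?m = "m (card ?T) ?T" and ?\<rho> = "\<lambda>x. \<lambda>i\<in>{..<N}. x (phi N u i)"
  have one: "?one \<in> A_space X N"
    by (auto simp: A_space_def image_constant_conv intro!: continuous_map_eq[of _ _ "\<lambda>_. 1"])
  have "(\<integral>x. b (?\<rho> x) \<partial>?m) \<le> (\<integral>x. c * ?one (?\<rho> x) \<partial>?m)"
  proof (rule integral_mono)
    show "integrable ?m (\<lambda>x. b (?\<rho> x))"
      by (rule integrable_h[OF meas u(1) b])
    show "integrable ?m (\<lambda>x. c * ?one (?\<rho> x))"
      using integrable_h[OF meas u(1) one] by simp
    fix x assume "x \<in> space ?m"
    then have "?\<rho> x \<in> topspace (pow_top X N)"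
      unfolding space_measure_family[OF meas(1,3) u(1)] by (rule phi_image_in_pow_top)
    then show "b (?\<rho> x) \<le> c * ?one (?\<rho> x)"
      using distinct_times_le[OF X u le] by (simp del: topspace_product_topology)
  qed
  then show ?thesis
    by (simp add: h_star_class[OF meas])
qed

theorem theorem5:
  fixes X0 :: "'a topology" and X :: "'a option topology"
    and \<Sigma> :: "'a option set set" and I :: "real set"
    and m :: "nat \<Rightarrow> real set \<Rightarrow> (nat \<Rightarrow> 'a option) measure"
    and i_star :: "((real \<Rightarrow> 'a option) \<Rightarrow> real) \<Rightarrow> real"
  assumes "topspace X0 \<noteq> {}" "locally_compact_space X0" "normal_space X0" "Hausdorff_space X0"
    and "X = compactified X0"
    and "sigma_algebra (topspace X) \<Sigma>" "continuous_measurable X \<Sigma>"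
    and "is_interval I" "I \<noteq> {}"
    and "measure_family I X \<Sigma> m"
    and "linear_functional_on (topspace (path_top I X)) (H_star I X ` V_space I X) i_star"
    and "\<forall>v\<in>V_space I X. i_star (H_star I X v) = h_star I X m v"
  shows "\<exists>F. linear_functional_on (topspace (path_top I X)) (C_space (path_top I X)) F
     \<and> continuous_map (uniform_top (path_top I X)) euclideanreal F
     \<and> (\<forall>f\<in>H_star I X ` V_space I X. F f = i_star f)"
proof -
  let ?P = "topspace (path_top I X)" and ?S = "H_star I X ` V_space I X"
  have X: "compact_space X"
    unfolding assms(5) by (rule compact_space_compactified)
  have ne: "topspace X \<noteq> {}"
    using assms(1) unfolding assms(5)
    by (simp add: compactified_def del: null_topspace_iff_trivial)
  have P: "compact_space (path_top I X)" "?P \<noteq> {}"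
    using X ne by (auto simp: compact_space_product_topology PiE_eq_empty_iff
        simp del: null_topspace_iff_trivial)
  \<comment> \<open>On the compact path space, \<open>C_space\<close> is the carrier of
    \<open>cfunspace\<close>, whose members are bounded. Hence a functional on bounded functions
    restricts to it.\<close>
  have bdC: "bounded (f ` ?P)" if "f \<in> C_space (path_top I X)" for f
    using that topspace_uniform_top[OF P(1)] by auto
  let ?one = "\<lambda>\<pi>\<in>?P. 1 :: real"
  \<comment> \<open>The empty tuple of times, whose extensional representative is constantly
    \<open>undefined\<close>. It shows that \<open>?S\<close> is nonempty and that
    \<open>i_star ?one\<close> is the integral of a nonnegative function.\<close>
  define t0 :: "nat \<Rightarrow> real" where "t0 = (\<lambda>_. undefined)"
  have one_in: "V_class I X n t (\<lambda>x\<in>topspace (pow_top X n). 1) \<in> V_space I X"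
    if "t \<in> I_tuples I n" for n t
    using that by (intro V_class_in_V_space A_space_compactI X) auto
  have t0: "t0 \<in> I_tuples I 0"
    by (simp add: t0_def I_tuples_def)
  \<comment> \<open>The total mass in \<open>h_star_bound\<close> depends on the tuple, which varies
    with the function being bounded. Factoring through \<open>i_star\<close> forces all these masses
    to agree, so one constant works for every \<open>f\<close> in \<open>bound\<close>.\<close>
  have i_one: "i_star ?one = h_star I X m (V_class I X n t (\<lambda>x\<in>topspace (pow_top X n). 1))"
    if "t \<in> I_tuples I n" for n t
    using assms(12) one_in[OF that] H_star_one[OF that] by metis
  have bound: "i_star f \<le> i_star ?one * c" if f: "f \<in> ?S" "\<And>\<pi>. \<pi> \<in> ?P \<Longrightarrow> f \<pi> \<le> c" for f c
  proof -
    obtain v where v: "v \<in> V_space I X" "f = H_star I X v"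
      using f(1) by auto
    obtain N u b where u: "u \<in> I_tuples I N" "inj_on u {..<N}" and b: "b \<in> A_space X N"
      and eq: "f = H_star I X (V_class I X N u b)"
      using H_star_distinct_times[OF X v(1)] v(2) by metis
    have "h_star I X m (V_class I X N u b)
      \<le> c * h_star I X m (V_class I X N u (\<lambda>x\<in>topspace (pow_top X N). 1))"
      using f(2) unfolding eq by (rule h_star_bound[OF ne assms(6,7,10) u b])
    then show ?thesis
      using assms(12) V_class_in_V_space[OF u(1) b] i_one[OF u(1)] eq by (simp add: mult.commute)
  qed
  have nonneg: "0 \<le> i_star ?one"
    unfolding i_one[OF t0] h_star_class[OF assms(6,7,10)]
    by (intro integral_nonneg_AE AE_I2) (auto simp: restrict_def)
  have bdS: "bounded (f ` ?P)" if f: "f \<in> ?S" for f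
  proof -
    obtain v where v: "v \<in> V_space I X" "f = H_star I X v"
      using f by auto
    obtain N u b where u: "u \<in> I_tuples I N" and b: "b \<in> A_space X N"
      and eq: "f = H_star I X (V_class I X N u b)"
      using H_star_distinct_times[OF X v(1)] v(2) by metis
    have "f ` ?P \<subseteq> b ` topspace (pow_top X N)"
    proof (rule image_subsetI)
      fix \<pi> assume \<pi>: "\<pi> \<in> ?P"
      then have "(\<lambda>i\<in>{..<N}. \<pi> (u i)) \<in> topspace (pow_top X N)"
        using u by (auto simp: I_tuples_def PiE_iff)
      then show "f \<pi> \<in> b ` topspace (pow_top X N)"
        unfolding eq H_star_class[OF \<pi>] by (rule imageI)
    qed
    then show ?thesis
      using b bounded_subset by (auto simp: A_space_def)
  qed
  show ?thesis
  proof (rule extend_bounded_functional[OF P(2) _ _ _ _ assms(11) _ nonneg])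
    show "?S \<noteq> {}"
      using one_in[OF t0] by auto
    show "?S \<subseteq> extensional ?P"
      by (auto simp: H_star_def)
    show "(\<lambda>p\<in>?P. f p + r * g p) \<in> ?S" if fg: "f \<in> ?S" "g \<in> ?S" for f g r
    proof -
      obtain v w where vw: "v \<in> V_space I X" "w \<in> V_space I X" "f = H_star I X v" "g = H_star I X w"
        using fg by blast
      show ?thesis
        unfolding vw(3,4) H_star_linear[OF vw(1,2), symmetric]
        by (rule imageI[OF V_space_closed(1)[OF vw(1,2)]])
    qed
    show "bounded (f ` ?P)" if "f \<in> ?S" for f
      by (rule bdS[OF that])
    show "i_star f \<le> i_star ?one * c" if "f \<in> ?S" "\<And>\<pi>. \<pi> \<in> ?P \<Longrightarrow> f \<pi> \<le> c" for f c
      by (rule bound[OF that])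
  next
    fix F assume F: "linear_functional_on ?P {f. bounded (f ` ?P)} F"
      "\<And>f c. bounded (f ` ?P) \<Longrightarrow> (\<And>p. p \<in> ?P \<Longrightarrow> \<bar>f p\<bar> \<le> c) \<Longrightarrow> \<bar>F f\<bar> \<le> i_star ?one * c"
      "\<And>f. f \<in> ?S \<Longrightarrow> F f = i_star f"
    show ?thesis
    proof (intro exI[of _ F] conjI ballI)
      show "linear_functional_on ?P (C_space (path_top I X)) F"
        using F(1) bdC by (simp add: linear_functional_on_def)
      \<comment> \<open>The estimate for \<open>F\<close>, applied to \<open>f - g\<close> with the
        sup distance as pointwise bound, gives the Lipschitz constant \<open>i_star ?one\<close> and
        hence continuity.\<close>
      have "\<bar>F f - F g\<bar> \<le> i_star ?one * mdist (cfunspace (path_top I X) euclidean_metric) f g"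
        if fg: "f \<in> mspace (cfunspace (path_top I X) euclidean_metric)"
          "g \<in> mspace (cfunspace (path_top I X) euclidean_metric)" for f g
      proof -
        have bd: "bounded (f ` ?P)" "bounded (g ` ?P)"
          using fg by auto
        have "F (\<lambda>p\<in>?P. f p + (-1) * g p) = F f + (-1) * F g"
          using F(1) bd unfolding linear_functional_on_def by blast
        moreover have "\<bar>F (\<lambda>p\<in>?P. f p + (-1) * g p)\<bar>
            \<le> i_star ?one * mdist (cfunspace (path_top I X) euclidean_metric) f g"
        proof (rule F(2)[OF bounded_linear_combination[OF bd]])
          show "\<bar>(\<lambda>p\<in>?P. f p + (-1) * g p) p\<bar> \<le> mdist (cfunspace (path_top I X) euclidean_metric) f g"
            if "p \<in> ?P" for p
            using mdist_cfunspace_imp_mdist_le[OF fg order_refl that] that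
            by (simp add: dist_real_def)
        qed
        ultimately show ?thesis by simp
      qed
      then have "Lipschitz_continuous_map (cfunspace (path_top I X) euclidean_metric) euclidean_metric F"
        unfolding Lipschitz_continuous_map_def
        by (auto simp: dist_real_def simp del: mspace_cfunspace)
      then show "continuous_map (uniform_top (path_top I X)) euclideanreal F"
        using Lipschitz_continuous_imp_continuous_map by fastforce
      show "F f = i_star f" if "f \<in> ?S" for f
        by (rule F(3)[OF that])
    qed
  qed
qed

end
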